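(* Let $q\in\mathbb{C}$ with $|q|<1$, let $r\ge1$, let $a_1,\dots,a_r,b_1,\dots,b_r$ be positive integers, let $x\in\mathbb{C}$ with $x\neq-\sum_{j=1}^r a_jn_j$ for all nonnegative integers $n_1,\dots,n_r$, and let $n$ be an odd positive integer. Then $$\zeta_r(-n,x\mid a_1,\dots,a_r;b_1,\dots,b_r)=E^{(r)}_{n,q}(x\mid a_1,\dots,a_r;b_1,\dots,b_r).$$
   Context: For $s\in\mathbb{C}$, the multivariate $q$-zeta function is $$\zeta_r(s,x\mid a_1,\dots,a_r;b_1,\dots,b_r)=\sum_{n_1,\dots,n_r=0}^{\infty}\frac{2^r(-1)^{\sum_{j=1}^r n_j}q^{\sum_{j=1}^r b_jn_j}}{\big(\sum_{j=1}^r a_jn_j+x\big)^s}$$ (principal branch of the power). The multivariate $q$-Euler polynomials $E^{(r)}_{n,q}(x\mid a_1,\dots,a_r;b_1,\dots,b_r)$ are defined by the generating function $$\frac{2^r}{\prod_{j=1}^r(q^{b_j}e^{a_jt}+1)}\,e^{xt}=\sum_{n=0}^{\infty}E^{(r)}_{n,q}(x\mid a_1,\dots,a_r;b_1,\dots,b_r)\frac{t^n}{n!}.$$ *)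

theory Defs
  imports
    "HOL-Analysis.Analysis"
    "HOL-Computational_Algebra.Formal_Power_Series"
begin

text \<open>
  The parameters \<open>a\<^sub>1, \<dots>, a\<^sub>r\<close> and \<open>b\<^sub>1, \<dots>, b\<^sub>r\<close> are functions on \<open>nat\<close> of which only the values
  on \<open>{1..r}\<close> are used; the multiple series runs over all \<open>(n\<^sub>1, \<dots>, n\<^sub>r)\<close>, represented by the
  extensional functions on \<open>{1..r}\<close>.  The complex \<open>powr\<close> is the principal branch.
\<close>

definition multi_q_zeta ::
  "complex \<Rightarrow> nat \<Rightarrow> complex \<Rightarrow> complex \<Rightarrow> (nat \<Rightarrow> nat) \<Rightarrow> (nat \<Rightarrow> nat) \<Rightarrow> complex" where
  "multi_q_zeta q r s x a b =
     (\<Sum>\<^sub>\<infinity>k\<in>{1..r} \<rightarrow>\<^sub>E (UNIV :: nat set).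
        2 ^ r * (-1) ^ (\<Sum>j=1..r. k j) * q ^ (\<Sum>j=1..r. b j * k j) /
        ((of_nat (\<Sum>j=1..r. a j * k j) + x) powr s))"

text \<open>
  The generating function is read as a formal power series in \<open>t\<close>.  The division is by a unit
  when \<open>\<bar>q\<bar> < 1\<close> and all \<open>b\<^sub>j\<close> are positive: the denominator has constant
  term \<open>\<Prod>\<^sub>j (q ^ b\<^sub>j + 1) \<noteq> 0\<close>.
\<close>

definition multi_q_euler_gf ::
  "complex \<Rightarrow> nat \<Rightarrow> complex \<Rightarrow> (nat \<Rightarrow> nat) \<Rightarrow> (nat \<Rightarrow> nat) \<Rightarrow> complex fps" where
  "multi_q_euler_gf q r x a b =
     fps_const (2 ^ r) / (\<Prod>j=1..r. fps_const (q ^ b j) * fps_exp (of_nat (a j)) + 1) * fps_exp x"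

definition multi_q_euler ::
  "complex \<Rightarrow> nat \<Rightarrow> nat \<Rightarrow> complex \<Rightarrow> (nat \<Rightarrow> nat) \<Rightarrow> (nat \<Rightarrow> nat) \<Rightarrow> complex" where
  "multi_q_euler q r n x a b = fact n * fps_nth (multi_q_euler_gf q r x a b) n"

end

theory Submission
  imports Defs
begin

text \<open>
  For \<open>\<bar>c\<bar> < 1\<close> the coefficients of \<open>1 / (1 - c e\<^sup>a\<^sup>t)\<close> are those of the
  geometric series \<open>\<Sum>m. c\<^sup>m e\<^sup>a\<^sup>m\<^sup>t\<close>, each being an absolutely convergent
  series.  Multiplying these expansions for \<open>c = - q ^ b\<^sub>j\<close>, \<open>j = 1, \<dots>, r\<close>, and \<open>e\<^sup>x\<^sup>t\<close>
  exhibits the \<open>n\<close>-th coefficient of the generating function as the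
  multiple series defining the zeta function at \<open>-n\<close>.
\<close>

lemma has_sum_sum:
  fixes f :: "'i \<Rightarrow> 'a \<Rightarrow> 'b :: topological_comm_monoid_add"
  assumes "\<And>i. i \<in> I \<Longrightarrow> (f i has_sum S i) A"
  shows "((\<lambda>x. \<Sum>i\<in>I. f i x) has_sum (\<Sum>i\<in>I. S i)) A"
  using assms by (induction I rule: infinite_finite_induct) (auto intro!: has_sum_add)

text \<open>Unconditional summability of complex families is absolute, so the norms of the products
  can be summed iteratively. This gives the joint summability that allows the iterated sum to be
  read as a sum over \<open>A \<times> B\<close>.\<close>

lemma has_sum_mult_Times_complex:
  fixes f :: "'a \<Rightarrow> complex" and g :: "'b \<Rightarrow> complex"
  assumes f: "(f has_sum S) A" and g: "(g has_sum T) B"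
  shows "((\<lambda>(x, y). f x * g y) has_sum S * T) (A \<times> B)"
proof (rule has_sum_SigmaI)
  show "((\<lambda>y. case (x, y) of (x, y) \<Rightarrow> f x * g y) has_sum f x * T) B" for x
    using has_sum_cmult_right[OF g] by simp
  show "((\<lambda>x. f x * T) has_sum S * T) A"
    by (rule has_sum_cmult_left[OF f])
  have nf: "(\<lambda>x. norm (f x)) summable_on A"
    using f summable_on_iff_abs_summable_on_complex has_sum_imp_summable by blast
  have ng: "(\<lambda>y. norm (g y)) summable_on B"
    using g summable_on_iff_abs_summable_on_complex has_sum_imp_summable by blast
  have "(\<lambda>p. norm (case p of (x, y) \<Rightarrow> f x * g y)) summable_on A \<times> B"
  proof (rule summable_on_SigmaI)
    show "((\<lambda>y. norm (case (x, y) of (x, y) \<Rightarrow> f x * g y)) has_sum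
            norm (f x) * infsum (\<lambda>y. norm (g y)) B) B" for x
      using has_sum_cmult_right[OF has_sum_infsum[OF ng]] by (simp add: norm_mult)
    show "(\<lambda>x. norm (f x) * infsum (\<lambda>y. norm (g y)) B) summable_on A"
      by (rule summable_on_cmult_left[OF nf])
  qed simp
  then show "(\<lambda>(x, y). f x * g y) summable_on A \<times> B"
    by (rule abs_summable_summable)
qed

lemma summable_of_nat_power_mult_power:
  fixes c :: "'a :: {real_normed_field, banach}"
  assumes "norm c < 1"
  shows "summable (\<lambda>m. of_nat m ^ i * c ^ m)"
  using assms
proof (induction i arbitrary: c)
  case 0
  then show ?case by (simp add: summable_geometric)
next
  case (Suc i)
  \<comment> \<open>Termwise differentiation raises the power of the index by one. It uses
    convergence on the whole open unit disc, hence the induction with \<open>c\<close>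
    arbitrary.\<close>
  have "summable (\<lambda>m. diffs (\<lambda>m. of_nat m ^ i) m * c ^ m)"
    by (rule termdiff_converges[OF Suc.prems Suc.IH])
  \<comment> \<open>Differentiation pairs the coefficient \<open>(m + 1) ^ Suc i\<close> with
    \<open>c ^ m\<close>; the factor \<open>c\<close> realigns the exponent.\<close>
  then have "summable (\<lambda>m. c * (diffs (\<lambda>m. of_nat m ^ i) m * c ^ m))"
    by (rule summable_mult)
  then have "summable (\<lambda>m. of_nat (Suc m) ^ Suc i * c ^ Suc m)"
    by (simp add: diffs_def mult_ac)
  then show ?case
    by (subst (asm) summable_Suc_iff)
qed

text \<open>The series is summed coefficientwise to a formal power series \<open>S\<close>.
  Multiplication by \<open>c\<close> times the exponential shifts its terms by one, so it turns
  \<open>S\<close> into \<open>S - 1\<close>, and \<open>S\<close> is the inverse.\<close>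

lemma fps_nth_inverse_one_minus_exp_has_sum:
  fixes c a :: complex
  assumes "norm c < 1"
  shows "((\<lambda>m. c ^ m * fps_nth (fps_exp (of_nat m * a)) i) has_sum
           fps_nth (inverse (1 - fps_const c * fps_exp a)) i) UNIV"
proof -
  define u where "u i m = c ^ m * fps_nth (fps_exp (of_nat m * a)) i" for i m
  define S where "S = Abs_fps (\<lambda>i. \<Sum>m. u i m)"
  have abs_u: "summable (\<lambda>m. norm (u i m))" for i
  proof -
    \<comment> \<open>The coefficient is \<open>(m * a) ^ i / i!\<close>, which leaves a polynomial
      factor times a geometric one.\<close>
    have "summable (\<lambda>m. (norm a ^ i / fact i) * (of_nat m ^ i * norm c ^ m))"
      by (intro summable_mult summable_of_nat_power_mult_power) (use assms in simp)
    then show ?thesis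
      by (simp add: u_def norm_mult norm_power norm_divide power_mult_distrib mult_ac)
  qed
  have u_sums: "u i sums fps_nth S i" for i
    using abs_u[of i] by (simp add: S_def summable_norm_cancel summable_sums)
  have "(fps_const c * fps_exp a) * S = S - 1"
  proof (rule fps_ext)
    fix i
    \<comment> \<open>Splitting one factor off the exponential gives a finite convolution, so
      summation over \<open>m\<close> can pass inside it.\<close>
    have shift: "u i (Suc m) = (\<Sum>k=0..i. fps_nth (fps_const c * fps_exp a) k * u (i - k) m)" for m
    proof -
      have "u i (Suc m) = c ^ m * fps_nth (fps_const c * fps_exp a * fps_exp (of_nat m * a)) i"
        by (simp add: u_def fps_exp_add_mult distrib_right mult.assoc del: fps_exp_nth)
      then show ?thesis
        unfolding fps_mult_nth[of "fps_const c * fps_exp a"] u_def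
        by (simp add: sum_distrib_left mult_ac)
    qed
    have "(\<lambda>m. u i (Suc m)) sums fps_nth ((fps_const c * fps_exp a) * S) i"
      unfolding shift fps_mult_nth[of "fps_const c * fps_exp a"]
      by (intro sums_sum sums_mult u_sums)
    moreover have "(\<lambda>m. u i (Suc m)) sums (fps_nth S i - u i 0)"
      using u_sums sums_Suc_iff by fastforce
    moreover have "u i 0 = fps_nth 1 i"
      by (simp add: u_def)
    ultimately show "fps_nth ((fps_const c * fps_exp a) * S) i = fps_nth (S - 1) i"
      using sums_unique2[of "\<lambda>m. u i (Suc m)"] by (metis fps_sub_nth)
  qed
  then have "(1 - fps_const c * fps_exp a) * S = 1"
    by (simp add: algebra_simps)
  then have "inverse (1 - fps_const c * fps_exp a) = S"
    by (rule fps_inverse_unique)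
  then show ?thesis
    using norm_summable_imp_has_sum[OF abs_u u_sums, of i] by (simp add: u_def[abs_def])
qed

text \<open>Induction on \<open>J\<close>: a new factor enters through a Cauchy product of
  coefficients. This involves all coefficients up to \<open>n\<close> of the remaining product, so
  \<open>n\<close> is generalized.\<close>

lemma fps_nth_prod_inverse_one_minus_exp_has_sum:
  fixes c a :: "'i \<Rightarrow> complex"
  assumes "finite J" and "\<And>j. j \<in> J \<Longrightarrow> norm (c j) < 1"
  shows "((\<lambda>k. (\<Prod>j\<in>J. c j ^ k j) * fps_nth (fps_exp ((\<Sum>j\<in>J. of_nat (k j) * a j) + x)) n) has_sum
           fps_nth ((\<Prod>j\<in>J. inverse (1 - fps_const (c j) * fps_exp (a j))) * fps_exp x) n)
         (J \<rightarrow>\<^sub>E UNIV)"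
  using assms
proof (induction J arbitrary: n rule: finite_induct)
  case empty
  show ?case
    \<comment> \<open>The only extensional function on the empty set contributes the coefficient of
      \<open>fps_exp x\<close>.\<close>
    using has_sum_finite[of "{\<lambda>_. undefined}"] by simp
next
  case (insert i J)
  define w where "w k = (\<Prod>j\<in>J. c j ^ k j)" for k
  define E where "E k = fps_exp ((\<Sum>j\<in>J. of_nat (k j) * a j) + x)" for k :: "'i \<Rightarrow> nat"
  define G where "G = inverse (1 - fps_const (c i) * fps_exp (a i))"
  define P where "P = (\<Prod>j\<in>J. inverse (1 - fps_const (c j) * fps_exp (a j))) * fps_exp x"
  define F where "F k = (\<Prod>j\<in>insert i J. c j ^ k j) *
    fps_nth (fps_exp ((\<Sum>j\<in>insert i J. of_nat (k j) * a j) + x)) n" for k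
  have tail: "((\<lambda>k. w k * fps_nth (E k) l) has_sum fps_nth P l) (J \<rightarrow>\<^sub>E UNIV)" for l
    unfolding w_def E_def P_def by (rule insert.IH) (use insert.prems in auto)
  have head: "((\<lambda>m. c i ^ m * fps_nth (fps_exp (of_nat m * a i)) l) has_sum fps_nth G l) UNIV" for l
    unfolding G_def by (rule fps_nth_inverse_one_minus_exp_has_sum) (use insert.prems in auto)
  have "((\<lambda>p. \<Sum>l=0..n. case p of (m, k) \<Rightarrow>
           (c i ^ m * fps_nth (fps_exp (of_nat m * a i)) l) * (w k * fps_nth (E k) (n - l))) has_sum
         (\<Sum>l=0..n. fps_nth G l * fps_nth P (n - l))) (UNIV \<times> (J \<rightarrow>\<^sub>E UNIV))"
    by (intro has_sum_sum has_sum_mult_Times_complex head tail)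
  also have "(\<lambda>p. \<Sum>l=0..n. case p of (m, k) \<Rightarrow>
           (c i ^ m * fps_nth (fps_exp (of_nat m * a i)) l) * (w k * fps_nth (E k) (n - l))) =
         (\<lambda>p. F ((\<lambda>(m, k). k(i := m)) p))"
  proof (clarsimp simp: fun_eq_iff simp del: fps_exp_nth)
    fix m and k :: "'i \<Rightarrow> nat"
    have "(\<Prod>j\<in>J. c j ^ (k(i := m)) j) = w k"
      unfolding w_def using insert.hyps by (intro prod.cong) auto
    then have 1: "(\<Prod>j\<in>insert i J. c j ^ (k(i := m)) j) = c i ^ m * w k"
      using insert.hyps by simp
    have "(\<Sum>j\<in>insert i J. of_nat ((k(i := m)) j) * a j) =
        of_nat m * a i + (\<Sum>j\<in>J. of_nat (k j) * a j)"
      using insert.hyps by (auto intro!: sum.cong)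
    then have 2: "fps_exp ((\<Sum>j\<in>insert i J. of_nat ((k(i := m)) j) * a j) + x) =
        fps_exp (of_nat m * a i) * E k"
      by (simp only: E_def add.assoc fps_exp_add_mult)
    show "(\<Sum>l=0..n. c i ^ m * fps_nth (fps_exp (of_nat m * a i)) l * (w k * fps_nth (E k) (n - l))) =
        F (k(i := m))"
      unfolding F_def 1 2 fps_mult_nth by (simp add: sum_distrib_left mult_ac del: fps_exp_nth)
  qed
  also have "(\<Sum>l=0..n. fps_nth G l * fps_nth P (n - l)) = fps_nth (G * P) n"
    by (simp add: fps_mult_nth)
  \<comment> \<open>Since \<open>i\<close> lies outside \<open>J\<close>, setting the value at
    \<open>i\<close> is injective on these pairs, so the double sum can be reindexed along
    it.\<close>
  finally have "(F has_sum fps_nth (G * P) n) ((\<lambda>(m, k). k(i := m)) ` (UNIV \<times> (J \<rightarrow>\<^sub>E UNIV)))"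
    unfolding has_sum_reindex[OF inj_combinator[OF insert.hyps(2), of "\<lambda>_. UNIV"]] o_def .
  then have "(F has_sum fps_nth (G * P) n) (insert i J \<rightarrow>\<^sub>E UNIV)"
    by (simp add: PiE_insert_eq)
  then show ?case
    using insert.hyps by (simp add: F_def[abs_def] G_def P_def mult.assoc)
qed

theorem theorem3:
  fixes q x :: complex and r n :: nat and a b :: "nat \<Rightarrow> nat"
  assumes "norm q < 1"
    and "r \<ge> 1"
    and "\<And>j. j \<in> {1..r} \<Longrightarrow> a j > 0"
    and "\<And>j. j \<in> {1..r} \<Longrightarrow> b j > 0"
    and "\<And>k :: nat \<Rightarrow> nat. x \<noteq> - of_nat (\<Sum>j=1..r. a j * k j)"
    and "odd n" and "n > 0"
  shows "multi_q_zeta q r (- of_nat n) x a b = multi_q_euler q r n x a b"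
proof -
  \<comment> \<open>The sign turns each denominator factor into the geometric form
    \<open>D j\<close> and later supplies the alternating sign of the zeta series.\<close>
  define c where "c j = - (q ^ b j)" for j
  define D where "D j = 1 - fps_const (c j) * fps_exp (of_nat (a j))" for j
  have c_less: "norm (c j) < 1" if "j \<in> {1..r}" for j
    using assms(1) assms(4)[OF that] by (simp add: c_def norm_power power_less_one_iff)
  have D0: "fps_nth (D j) 0 \<noteq> 0" if "j \<in> {1..r}" for j
    using c_less[OF that] by (auto simp: D_def)
  have prod_D: "(\<Prod>j=1..r. D j) * (\<Prod>j=1..r. inverse (D j)) = 1"
    by (simp add: D0 inverse_mult_eq_1' flip: prod.distrib)
  \<comment> \<open>A nonzero constant term makes the denominator a unit, so the division becomes
    multiplication by the inverse.\<close>
  then have "fps_nth (\<Prod>j=1..r. D j) 0 \<noteq> 0"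
    by (metis fps_mult_nth_0 fps_one_nth mult_zero_left zero_neq_one)
  moreover have "inverse (\<Prod>j=1..r. D j) = (\<Prod>j=1..r. inverse (D j))"
    by (rule fps_inverse_unique[OF prod_D])
  moreover have "(\<Prod>j=1..r. fps_const (q ^ b j) * fps_exp (of_nat (a j)) + 1) = (\<Prod>j=1..r. D j)"
    by (simp add: D_def c_def add.commute flip: fps_const_neg)
  ultimately have "multi_q_euler_gf q r x a b =
      fps_const (2 ^ r) * ((\<Prod>j=1..r. inverse (D j)) * fps_exp x)"
    by (simp add: multi_q_euler_gf_def fps_divide_unit mult.assoc)
  then have euler: "multi_q_euler q r n x a b =
      fact n * 2 ^ r * fps_nth ((\<Prod>j=1..r. inverse (D j)) * fps_exp x) n"
    by (simp add: multi_q_euler_def)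
  have "((\<lambda>k. fact n * 2 ^ r * ((\<Prod>j=1..r. c j ^ k j) *
           fps_nth (fps_exp ((\<Sum>j=1..r. of_nat (k j) * of_nat (a j)) + x)) n)) has_sum
         multi_q_euler q r n x a b) ({1..r} \<rightarrow>\<^sub>E UNIV)"
    unfolding euler D_def
    by (intro has_sum_cmult_right fps_nth_prod_inverse_one_minus_exp_has_sum c_less) auto
  also have "(\<lambda>k. fact n * 2 ^ r * ((\<Prod>j=1..r. c j ^ k j) *
           fps_nth (fps_exp ((\<Sum>j=1..r. of_nat (k j) * of_nat (a j)) + x)) n)) =
      (\<lambda>k. 2 ^ r * (-1) ^ (\<Sum>j=1..r. k j) * q ^ (\<Sum>j=1..r. b j * k j) /
        ((of_nat (\<Sum>j=1..r. a j * k j) + x) powr (- of_nat n)))"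
  proof
    fix k :: "nat \<Rightarrow> nat"
    define z where "z = of_nat (\<Sum>j=1..r. a j * k j) + x"
    have "z \<noteq> 0"
      using assms(5)[of k] by (auto simp: z_def add_eq_0_iff)
    then have "z powr (- of_nat n) = inverse (z ^ n)"
      by (simp add: powr_minus powr_nat')
    moreover have "(\<Sum>j=1..r. of_nat (k j) * of_nat (a j)) + x = z"
      by (simp add: z_def mult.commute)
    moreover have "(\<Prod>j=1..r. c j ^ k j) = (-1) ^ (\<Sum>j=1..r. k j) * q ^ (\<Sum>j=1..r. b j * k j)"
    proof -
      have "c j ^ k j = (-1) ^ k j * q ^ (b j * k j)" for j
        unfolding c_def by (subst power_minus) (simp add: power_mult)
      then show ?thesis
        by (simp add: prod.distrib power_sum)
    qed
    \<comment> \<open>The coefficient of \<open>fps_exp z\<close> is \<open>z ^ n / n!\<close>: the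
      factorial cancels, and \<open>z ^ n\<close> is division by
      \<open>z powr (- of_nat n)\<close>.\<close>
    ultimately show "fact n * 2 ^ r * ((\<Prod>j=1..r. c j ^ k j) *
           fps_nth (fps_exp ((\<Sum>j=1..r. of_nat (k j) * of_nat (a j)) + x)) n) =
      2 ^ r * (-1) ^ (\<Sum>j=1..r. k j) * q ^ (\<Sum>j=1..r. b j * k j) /
        ((of_nat (\<Sum>j=1..r. a j * k j) + x) powr (- of_nat n))"
      unfolding z_def[symmetric] by (simp add: divide_inverse)
  qed
  finally show ?thesis
    unfolding multi_q_zeta_def by (rule infsumI)
qed

end
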